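(* Let $m\geq 3$ be odd, let $G$ be isomorphic to the dihedral group $D_{2m}$ of order $2m$, and let $\Gamma=\mathcal{E}_c^-(G)$. Then $\mathrm{Spec}(\Gamma)=\{(-1)^{m-1},(m-1)^1\}$, $\mathrm{L\text{-}spec}(\Gamma)=\{(0)^1,(m)^{m-1}\}$, $\mathrm{Q\text{-}spec}(\Gamma)=\{(m-2)^{m-1},(2(m-1))^1\}$, and $E(\Gamma)=LE(\Gamma)=LE^+(\Gamma)=2(m-1)$.
   Context: For elements $x,y$ of a group, $[x,y]=x^{-1}y^{-1}xy$, $[x,{}_1y]=[x,y]$ and $[x,{}_{k+1}y]=[[x,{}_ky],y]$ for $k\ge 1$. For a finite group $G$ with Fitting subgroup $F(G)$, $\mathcal{E}_c^-(G)$ is the simple undirected graph with vertex set $G\setminus F(G)$ in which distinct $x,y$ are adjacent iff $[x,{}_ky]\neq 1$ and $[y,{}_kx]\neq 1$ for all positive integers $k$. For a finite simple graph $\Gamma$ with vertex set $v(\Gamma)$, edge set $e(\Gamma)$, adjacency matrix $A$ and degree matrix $D$: $\mathrm{Spec}(\Gamma)$, $\mathrm{L\text{-}spec}(\Gamma)$, $\mathrm{Q\text{-}spec}(\Gamma)$ are the multisets of eigenvalues of $A$, $D-A$, $D+A$ respectively; in $\{(\alpha_1)^{n_1},\dots,(\alpha_k)^{n_k}\}$ the exponent $n_i$ is the multiplicity of $\alpha_i$. $E(\Gamma)=\sum_{\lambda\in \mathrm{Spec}(\Gamma)}|\lambda|$, $LE(\Gamma)=\sum_{\mu\in \mathrm{L\text{-}spec}(\Gamma)}\left|\mu-\frac{2|e(\Gamma)|}{|v(\Gamma)|}\right|$,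 $LE^+(\Gamma)=\sum_{\nu\in \mathrm{Q\text{-}spec}(\Gamma)}\left|\nu-\frac{2|e(\Gamma)|}{|v(\Gamma)|}\right|$, sums being with multiplicity. *)

theory Defs
  imports
    "HOL-Algebra.Generated_Groups"
    "HOL-Library.Multiset"
    "Jordan_Normal_Form.Char_Poly"
begin

text \<open>
  The dihedral group of order \<open>2m\<close> in normal form: \<open>(i, s)\<close> stands for \<open>a\<^sup>i b\<^sup>s\<close>
  (with \<open>s\<close> read as \<open>0\<close> or \<open>1\<close>), where \<open>a\<^sup>m = b\<^sup>2 = 1\<close> and \<open>b a = a\<^sup>-\<^sup>1 b\<close>.
  So \<open>(i, False)\<close> are the rotations and \<open>(i, True)\<close> the reflections.
\<close>

definition dihedral_group :: "nat \<Rightarrow> (int \<times> bool) monoid" where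
  "dihedral_group m =
     \<lparr> carrier = {0..<int m} \<times> UNIV,
       monoid.mult = (\<lambda>(i, s) (j, t). ((i + (if s then - j else j)) mod int m, s \<noteq> t)),
       one = (0, False) \<rparr>"

definition commutator :: "('a, 'b) monoid_scheme \<Rightarrow> 'a \<Rightarrow> 'a \<Rightarrow> 'a" where
  "commutator G x y = inv\<^bsub>G\<^esub> x \<otimes>\<^bsub>G\<^esub> inv\<^bsub>G\<^esub> y \<otimes>\<^bsub>G\<^esub> x \<otimes>\<^bsub>G\<^esub> y"

text \<open>
  \<open>engel G x y k\<close> is \<open>[x, \<^sub>k y]\<close>. The value \<open>x\<close> at \<open>k = 0\<close> only starts the recursion
  (it gives \<open>[x, \<^sub>1 y] = [x, y]\<close>); the graph below uses positive \<open>k\<close> only.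
\<close>

primrec engel :: "('a, 'b) monoid_scheme \<Rightarrow> 'a \<Rightarrow> 'a \<Rightarrow> nat \<Rightarrow> 'a" where
  "engel G x y 0 = x"
| "engel G x y (Suc k) = commutator G (engel G x y k) y"

primrec lower_central_series :: "('a, 'b) monoid_scheme \<Rightarrow> nat \<Rightarrow> 'a set" where
  "lower_central_series G 0 = carrier G"
| "lower_central_series G (Suc n) =
     generate G {commutator G x y | x y. x \<in> lower_central_series G n \<and> y \<in> carrier G}"

definition nilpotent_group :: "('a, 'b) monoid_scheme \<Rightarrow> bool" where
  "nilpotent_group G \<longleftrightarrow> group G \<and> (\<exists>n. lower_central_series G n = {\<one>\<^bsub>G\<^esub>})"

text \<open>
  The subgroup generated by all nilpotent normal subgroups; for finite groups this is the
  largest nilpotent normal subgroup (Fitting's theorem).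
\<close>

definition fitting_subgroup :: "('a, 'b) monoid_scheme \<Rightarrow> 'a set" where
  "fitting_subgroup G =
     generate G (\<Union>{N. N \<lhd> G \<and> nilpotent_group (G\<lparr>carrier := N\<rparr>)})"

record 'a sgraph =
  verts :: "'a set"
  edges :: "'a set set"

definition simple_graph :: "'a sgraph \<Rightarrow> bool" where
  "simple_graph \<Gamma> \<longleftrightarrow> (\<forall>e \<in> edges \<Gamma>. e \<subseteq> verts \<Gamma> \<and> card e = 2)"

definition vertex_degree :: "'a sgraph \<Rightarrow> 'a \<Rightarrow> nat" where
  "vertex_degree \<Gamma> v = card {e \<in> edges \<Gamma>. v \<in> e}"

text \<open>
  The matrices depend on an enumeration \<open>vs\<close> of the vertices. The spectra use an arbitrary
  fixed one, and the lemmas after their definitions show that the choice is irrelevant.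
\<close>

definition adjacency_matrix :: "'a sgraph \<Rightarrow> 'a list \<Rightarrow> real mat" where
  "adjacency_matrix \<Gamma> vs = mat (length vs) (length vs)
     (\<lambda>(i, j). if {vs ! i, vs ! j} \<in> edges \<Gamma> then 1 else 0)"

definition degree_matrix :: "'a sgraph \<Rightarrow> 'a list \<Rightarrow> real mat" where
  "degree_matrix \<Gamma> vs = mat (length vs) (length vs)
     (\<lambda>(i, j). if i = j then real (vertex_degree \<Gamma> (vs ! i)) else 0)"

definition vertex_list :: "'a sgraph \<Rightarrow> 'a list" where
  "vertex_list \<Gamma> = (SOME vs. distinct vs \<and> set vs = verts \<Gamma>)"

text \<open>
  Eigenvalues are counted with multiplicity as roots of the characteristic polynomial. Since
  the matrices below are real symmetric, all their eigenvalues are real and taking roots over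
  \<open>real\<close> loses none.
\<close>

definition eigenvalue_mset :: "real mat \<Rightarrow> real multiset" where
  "eigenvalue_mset M = proots (char_poly M)"

definition spec :: "'a sgraph \<Rightarrow> real multiset" where
  "spec \<Gamma> = eigenvalue_mset (adjacency_matrix \<Gamma> (vertex_list \<Gamma>))"

definition L_spec :: "'a sgraph \<Rightarrow> real multiset" where
  "L_spec \<Gamma> = eigenvalue_mset
     (degree_matrix \<Gamma> (vertex_list \<Gamma>) - adjacency_matrix \<Gamma> (vertex_list \<Gamma>))"

definition Q_spec :: "'a sgraph \<Rightarrow> real multiset" where
  "Q_spec \<Gamma> = eigenvalue_mset
     (degree_matrix \<Gamma> (vertex_list \<Gamma>) + adjacency_matrix \<Gamma> (vertex_list \<Gamma>))"

definition avg_degree :: "'a sgraph \<Rightarrow> real" where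
  "avg_degree \<Gamma> = 2 * real (card (edges \<Gamma>)) / real (card (verts \<Gamma>))"

definition energy :: "'a sgraph \<Rightarrow> real" where
  "energy \<Gamma> = (\<Sum>x\<in>#spec \<Gamma>. \<bar>x\<bar>)"

definition L_energy :: "'a sgraph \<Rightarrow> real" where
  "L_energy \<Gamma> = (\<Sum>x\<in>#L_spec \<Gamma>. \<bar>x - avg_degree \<Gamma>\<bar>)"

definition Q_energy :: "'a sgraph \<Rightarrow> real" where
  "Q_energy \<Gamma> = (\<Sum>x\<in>#Q_spec \<Gamma>. \<bar>x - avg_degree \<Gamma>\<bar>)"

definition engel_graph :: "('a, 'b) monoid_scheme \<Rightarrow> 'a sgraph" where
  "engel_graph G =
     \<lparr> verts = carrier G - fitting_subgroup G,
       edges = {{x, y} | x y. x \<in> carrier G - fitting_subgroup G \<and>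
                              y \<in> carrier G - fitting_subgroup G \<and> x \<noteq> y \<and>
                              (\<forall>k\<ge>1. engel G x y k \<noteq> \<one>\<^bsub>G\<^esub> \<and> engel G y x k \<noteq> \<one>\<^bsub>G\<^esub>)} \<rparr>"

lemma group_dihedral_group:
  assumes "m > 0"
  shows "group (dihedral_group m)"
proof (rule groupI)
  fix x y z assume xyz: "x \<in> carrier (dihedral_group m)" "y \<in> carrier (dihedral_group m)"
    "z \<in> carrier (dihedral_group m)"
  show "x \<otimes>\<^bsub>dihedral_group m\<^esub> y \<otimes>\<^bsub>dihedral_group m\<^esub> z =
        x \<otimes>\<^bsub>dihedral_group m\<^esub> (y \<otimes>\<^bsub>dihedral_group m\<^esub> z)"
    by (cases x; cases y; cases z) (auto simp: dihedral_group_def mod_simps algebra_simps)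
next
  fix x assume x: "x \<in> carrier (dihedral_group m)"
  obtain i s where xi: "x = (i, s)" by (cases x)
  let ?y = "(if s then i else (- i) mod int m, s)"
  have "?y \<in> carrier (dihedral_group m)" "?y \<otimes>\<^bsub>dihedral_group m\<^esub> x = \<one>\<^bsub>dihedral_group m\<^esub>"
    using x assms by (auto simp: xi dihedral_group_def mod_simps)
  then show "\<exists>y\<in>carrier (dihedral_group m). y \<otimes>\<^bsub>dihedral_group m\<^esub> x = \<one>\<^bsub>dihedral_group m\<^esub>"
    by blast
qed (use assms in \<open>auto simp: dihedral_group_def\<close>)

lemma order_dihedral_group: "Coset.order (dihedral_group m) = 2 * m"
  by (simp add: Coset.order_def dihedral_group_def card_cartesian_product)

lemma simple_graph_engel_graph: "simple_graph (engel_graph G)"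
  by (auto simp: simple_graph_def engel_graph_def)

lemma eigenvalue_mset_reorder:
  fixes f :: "'a \<Rightarrow> 'a \<Rightarrow> real"
  assumes vs: "distinct vs" and ws: "distinct ws" and eq: "set vs = set ws"
  defines "M \<equiv> \<lambda>us. mat (length us) (length us) (\<lambda>(i, j). f (us ! i) (us ! j))"
  shows "eigenvalue_mset (M vs) = eigenvalue_mset (M ws)"
proof -
  define n where "n = length vs"
  have n: "length vs = n" "length ws = n"
    using distinct_card[OF vs] distinct_card[OF ws] eq by (simp_all add: n_def)
  define P Q :: "real mat"
    where "P = mat n n (\<lambda>(i, j). if vs ! i = ws ! j then 1 else 0)"
      and "Q = mat n n (\<lambda>(i, j). if ws ! i = vs ! j then 1 else 0)"
  have ex: "\<exists>!j. j < n \<and> ws ! j = v" if "v \<in> set ws" for v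
    using that ws n by (metis in_set_conv_nth nth_eq_iff_index_eq)
  have ex': "\<exists>!j. j < n \<and> vs ! j = v" if "v \<in> set ws" for v
    using that vs n eq by (metis in_set_conv_nth nth_eq_iff_index_eq)
  have sum1: "(\<Sum>j\<in>{0..<n}. (if v = us ! j then 1 else 0) * g (us ! j)) = g v"
    if v: "v \<in> set ws" and us: "us = ws \<or> us = vs" for v us and g :: "'a \<Rightarrow> real"
  proof -
    have "\<exists>!j. j < n \<and> us ! j = v" using us ex[OF v] ex'[OF v] by (elim disjE) simp_all
    then obtain j0 where j0: "j0 < n \<and> us ! j0 = v"
      and un: "\<forall>j. j < n \<and> us ! j = v \<longrightarrow> j = j0"
      by (rule ex1E)
    have "(\<Sum>j\<in>{0..<n}. (if v = us ! j then 1 else 0) * g (us ! j)) =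
          (\<Sum>j\<in>{0..<n}. if j = j0 then g v else 0)"
    proof (rule sum.cong[OF refl])
      fix j assume "j \<in> {0..<n}"
      then have "v = us ! j \<longleftrightarrow> j = j0" using j0 un by (metis atLeastLessThan_iff)
      then show "(if v = us ! j then 1 else 0) * g (us ! j) = (if j = j0 then g v else 0)"
        using j0 by simp
    qed
    then show ?thesis using j0 by simp
  qed
  have mem: "vs ! i \<in> set ws" "ws ! i \<in> set ws" if "i < n" for i
    using that n eq by (metis nth_mem)+
  have "P * Q = 1\<^sub>m n"
  proof (rule eq_matI)
    fix i j assume ij: "i < dim_row (1\<^sub>m n)" "j < dim_col (1\<^sub>m n)"
    then have "(P * Q) $$ (i, j) =
      (\<Sum>k\<in>{0..<n}. (if vs ! i = ws ! k then 1 else 0) * (if ws ! k = vs ! j then 1 else 0))"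
      by (simp add: P_def Q_def scalar_prod_def)
    also have "\<dots> = (if vs ! i = vs ! j then 1 else 0)"
      using sum1[of "vs ! i" ws "\<lambda>v. if v = vs ! j then 1 else 0"] mem ij by simp
    finally show "(P * Q) $$ (i, j) = 1\<^sub>m n $$ (i, j)"
      using ij vs n by (simp add: nth_eq_iff_index_eq)
  qed (simp_all add: P_def Q_def)
  moreover have "Q * P = 1\<^sub>m n"
  proof (rule eq_matI)
    fix i j assume ij: "i < dim_row (1\<^sub>m n)" "j < dim_col (1\<^sub>m n)"
    then have "(Q * P) $$ (i, j) =
      (\<Sum>k\<in>{0..<n}. (if ws ! i = vs ! k then 1 else 0) * (if vs ! k = ws ! j then 1 else 0))"
      by (simp add: P_def Q_def scalar_prod_def)
    also have "\<dots> = (if ws ! i = ws ! j then 1 else 0)"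
      using sum1[of "ws ! i" vs "\<lambda>v. if v = ws ! j then 1 else 0"] mem ij by simp
    finally show "(Q * P) $$ (i, j) = 1\<^sub>m n $$ (i, j)"
      using ij ws n by (simp add: nth_eq_iff_index_eq)
  qed (simp_all add: P_def Q_def)
  moreover have "M vs = P * M ws * Q"
  proof (rule eq_matI)
    fix i j assume "i < dim_row (P * M ws * Q)" "j < dim_col (P * M ws * Q)"
    then have ij: "i < n" "j < n" by (simp_all add: P_def Q_def)
    have PM: "(P * M ws) $$ (i, k) = f (vs ! i) (ws ! k)" if "k < n" for k
      using that ij mem sum1[of "vs ! i" ws "\<lambda>v. f v (ws ! k)"]
      by (simp add: P_def M_def n scalar_prod_def)
    have "(P * M ws * Q) $$ (i, j) = (\<Sum>k\<in>{0..<n}. (P * M ws) $$ (i, k) * Q $$ (k, j))"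
      using ij by (simp add: P_def Q_def M_def n scalar_prod_def)
    also have "\<dots> = (\<Sum>k\<in>{0..<n}. (if vs ! j = ws ! k then 1 else 0) * f (vs ! i) (ws ! k))"
      using ij by (intro sum.cong refl) (auto simp: PM Q_def)
    also have "\<dots> = f (vs ! i) (vs ! j)"
      using sum1[of "vs ! j" ws "f (vs ! i)"] mem ij by simp
    finally show "M vs $$ (i, j) = (P * M ws * Q) $$ (i, j)"
      using ij by (simp add: M_def n)
  qed (simp_all add: P_def Q_def M_def n)
  ultimately have "similar_mat_wit (M vs) (M ws) P Q"
    by (auto simp: similar_mat_wit_def Let_def P_def Q_def M_def n)
  then have "similar_mat (M vs) (M ws)"
    by (auto simp: similar_mat_def)
  then show ?thesis
    by (simp add: eigenvalue_mset_def char_poly_similar)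
qed

lemma vertex_list:
  assumes "finite (verts \<Gamma>)"
  shows "distinct (vertex_list \<Gamma>)" "set (vertex_list \<Gamma>) = verts \<Gamma>"
proof -
  have "\<exists>vs. distinct vs \<and> set vs = verts \<Gamma>"
    using finite_distinct_list[OF assms] by blast
  then have "distinct (vertex_list \<Gamma>) \<and> set (vertex_list \<Gamma>) = verts \<Gamma>"
    unfolding vertex_list_def by (rule someI_ex)
  then show "distinct (vertex_list \<Gamma>)" "set (vertex_list \<Gamma>) = verts \<Gamma>" by blast+
qed

lemma
  assumes "distinct vs" "set vs = verts \<Gamma>"
  shows spec_eq: "spec \<Gamma> = eigenvalue_mset (adjacency_matrix \<Gamma> vs)"
    and L_spec_eq: "L_spec \<Gamma> = eigenvalue_mset (degree_matrix \<Gamma> vs - adjacency_matrix \<Gamma> vs)"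
    and Q_spec_eq: "Q_spec \<Gamma> = eigenvalue_mset (degree_matrix \<Gamma> vs + adjacency_matrix \<Gamma> vs)"
proof -
  have fin: "finite (verts \<Gamma>)" using assms(2) by (metis List.finite_set)
  let ?a = "\<lambda>u v. if {u, v} \<in> edges \<Gamma> then 1 else 0 :: real"
  let ?d = "\<lambda>u v. if u = v then real (vertex_degree \<Gamma> u) else 0"
  let ?M = "\<lambda>f us. mat (length us) (length us) (\<lambda>(i, j). f (us ! i) (us ! j)) :: real mat"
  have A: "adjacency_matrix \<Gamma> us = ?M ?a us" for us
    by (simp add: adjacency_matrix_def)
  have D: "degree_matrix \<Gamma> us = ?M ?d us" if "distinct us" for us
    using that by (auto simp: degree_matrix_def nth_eq_iff_index_eq intro!: eq_matI)
  have L: "degree_matrix \<Gamma> us - adjacency_matrix \<Gamma> us = ?M (\<lambda>u v. ?d u v - ?a u v) us"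
    and Q: "degree_matrix \<Gamma> us + adjacency_matrix \<Gamma> us = ?M (\<lambda>u v. ?d u v + ?a u v) us"
    if "distinct us" for us
    unfolding D[OF that] A by (auto intro!: eq_matI)
  note reorder = eigenvalue_mset_reorder[OF vertex_list(1)[OF fin] assms(1)]
  have set: "set (vertex_list \<Gamma>) = set vs"
    using vertex_list(2)[OF fin] assms(2) by simp
  show "spec \<Gamma> = eigenvalue_mset (adjacency_matrix \<Gamma> vs)"
    unfolding spec_def A by (rule reorder[OF set])
  show "L_spec \<Gamma> = eigenvalue_mset (degree_matrix \<Gamma> vs - adjacency_matrix \<Gamma> vs)"
    unfolding L_spec_def L[OF vertex_list(1)[OF fin]] L[OF assms(1)] by (rule reorder[OF set])
  show "Q_spec \<Gamma> = eigenvalue_mset (degree_matrix \<Gamma> vs + adjacency_matrix \<Gamma> vs)"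
    unfolding Q_spec_def Q[OF vertex_list(1)[OF fin]] Q[OF assms(1)] by (rule reorder[OF set])
qed

end

theory Submission
  imports Defs
begin

text \<open>
  In \<open>D\<^bsub>2m\<^esub>\<close> the iterated commutators of the reflections \<open>a\<^sup>i b\<close> and \<open>a\<^sup>j b\<close> are the rotations by
  \<open>(-2)\<^sup>k * 2 * (i - j)\<close>, which are nontrivial for odd \<open>m\<close> and \<open>i \<noteq> j\<close>. So no reflection lies in
  a nilpotent normal subgroup, the Fitting subgroup is the rotation group, and the graph is the
  complete graph on the \<open>m\<close> reflections. All three matrices of a complete graph have the form
  \<open>a I + b J\<close> with \<open>J\<close> the all-ones matrix.
\<close>

section \<open>Eigenvalues of a I + b J\<close>

lemma eigenvalue_mset_scalar_plus_ones:
  fixes a b :: real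
  assumes n: "n > 0"
  shows "eigenvalue_mset (mat n n (\<lambda>(i, j). if i = j then a + b else b)) =
         replicate_mset (n - 1) a + {# a + real n * b #}"
proof -
  define M where "M = mat n n (\<lambda>(i, j). if i = j then a + b else b)"
  define P Q :: "real mat"
    where "P = mat n n (\<lambda>(i, j). if i = j \<or> j = 0 then 1 else 0)"
      and "Q = mat n n (\<lambda>(i, j). if i = j then 1 else if j = 0 then - 1 else 0)"
  \<comment> \<open>With u the all-ones vector at index 0 of the basis, the columns of
    \<open>T\<close> record M u = (a + n b) u and M e_j = a e_j + b u.\<close>
  define T where "T = mat n n (\<lambda>(i, j). if i = j then if i = 0 then a + real n * b else a
                                          else if i = 0 then b else 0)"
  note defs = M_def P_def Q_def T_def
  text \<open>The columns of \<open>P\<close>, namely the all-ones vector and the unit vectors \<open>e\<^sub>1, \<dots>, e\<^sub>n\<^sub>-\<^sub>1\<close>, are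
    a basis in which \<open>M\<close> is upper triangular.\<close>
  have carrier: "M \<in> carrier_mat n n" "P \<in> carrier_mat n n" "Q \<in> carrier_mat n n"
      "T \<in> carrier_mat n n"
    by (simp_all add: defs)
  have entry: "(X * Y) $$ (i, j) = (\<Sum>k<n. X $$ (i, k) * Y $$ (k, j))"
    if "X \<in> carrier_mat n n" "Y \<in> carrier_mat n n" "i < n" "j < n" for X Y :: "real mat" and i j
    using that by (simp add: scalar_prod_def atLeast0LessThan)
  have P_row: "(\<Sum>k<n. P $$ (i, k) * g k) = (if i = 0 then g 0 else g 0 + g i)"
    if "i < n" for i and g :: "nat \<Rightarrow> real"
  proof -
    have "(\<Sum>k<n. P $$ (i, k) * g k) =
          (\<Sum>k<n. (if k = 0 then g 0 else 0) + (if k = i then if i = 0 then 0 else g i else 0))"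
      using that by (intro sum.cong) (auto simp: P_def)
    then show ?thesis using that n by (simp add: sum.distrib)
  qed
  have Q_row: "(\<Sum>k<n. Q $$ (i, k) * g k) = (if i = 0 then g 0 else g i - g 0)"
    if "i < n" for i and g :: "nat \<Rightarrow> real"
  proof -
    have "(\<Sum>k<n. Q $$ (i, k) * g k) =
          (\<Sum>k<n. (if k = i then g i else 0) - (if k = 0 then if i = 0 then 0 else g 0 else 0))"
      using that by (intro sum.cong) (auto simp: Q_def)
    then show ?thesis using that n by (simp add: sum_subtractf)
  qed
  have M_row: "(\<Sum>k<n. M $$ (i, k) * g k) = a * g i + b * (\<Sum>k<n. g k)"
    if "i < n" for i and g :: "nat \<Rightarrow> real"
  proof -
    have "(\<Sum>k<n. M $$ (i, k) * g k) = (\<Sum>k<n. (if k = i then a * g i else 0) + b * g k)"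
      using that by (intro sum.cong) (auto simp: M_def algebra_simps)
    then show ?thesis using that by (simp add: sum.distrib sum_distrib_left)
  qed
  have PQ: "P * Q = 1\<^sub>m n"
    using n carrier by (intro eq_matI) (auto simp: entry P_row Q_def simp del: index_mult_mat(1))
  have QP: "Q * P = 1\<^sub>m n"
    using n carrier by (intro eq_matI) (auto simp: entry Q_row P_def simp del: index_mult_mat(1))
  \<comment> \<open>In \<open>M * P\<close> the unweighted sum in \<open>M_row\<close> runs over a
    column of \<open>P\<close>: the all-ones vector for j = 0, a unit vector otherwise.\<close>
  have col_P: "(\<Sum>k<n. P $$ (k, j)) = (if j = 0 then real n else 1)" if "j < n" for j
    using that by (auto simp: P_def)
  have "M * P = P * T"
  proof (rule eq_matI)
    fix i j assume "i < dim_row (P * T)" "j < dim_col (P * T)"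
    then have ij: "i < n" "j < n" using carrier by auto
    show "(M * P) $$ (i, j) = (P * T) $$ (i, j)"
      using ij n by (auto simp: entry[OF carrier(1,2)] entry[OF carrier(2,4)] M_row P_row col_P
          simp del: index_mult_mat(1)) (auto simp: P_def T_def algebra_simps)
  qed (use carrier in auto)
  then have "M = P * T * Q"
    using carrier PQ by (metis assoc_mult_mat right_mult_one_mat)
  then have "similar_mat M T"
    using carrier PQ QP by (intro similar_matI[of _ _ P Q n]) auto
  then have "char_poly M = char_poly T"
    by (rule char_poly_similar)
  also have "\<dots> = (\<Prod>d\<leftarrow>diag_mat T. [:- d, 1:])"
    by (rule char_poly_upper_triangular[OF carrier(4)]) (auto simp: T_def)
  also have "diag_mat T = (a + real n * b) # replicate (n - 1) a"
    using n by (intro nth_equalityI) (auto simp: diag_mat_def T_def nth_Cons')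
  finally have "char_poly M = [:- (a + real n * b), 1:] * [:- a, 1:] ^ (n - 1)"
    by (simp add: prod_list_replicate)
  \<comment> \<open>The linear factors stay unexpanded, so that each contributes its root with its
    exponent as multiplicity.\<close>
  then show ?thesis
    by (simp add: eigenvalue_mset_def M_def[symmetric] proots_mult proots_power del: mult_pCons_left)
qed

section \<open>Spectra and energies of complete graphs\<close>

text \<open>Taking the edges as 2-element subsets makes their number a binomial coefficient.\<close>

definition complete_graph :: "'a set \<Rightarrow> 'a sgraph" where
  "complete_graph V = \<lparr> verts = V, edges = {e. e \<subseteq> V \<and> card e = 2} \<rparr>"

lemma edges_complete_graph_iff:
  "{x, y} \<in> edges (complete_graph V) \<longleftrightarrow> x \<in> V \<and> y \<in> V \<and> x \<noteq> y"
  by (auto simp: complete_graph_def card_2_iff doubleton_eq_iff)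

lemma vertex_degree_complete_graph:
  assumes "finite V" "v \<in> V"
  shows "vertex_degree (complete_graph V) v = card V - 1"
proof -
  have "{e \<in> edges (complete_graph V). v \<in> e} = (\<lambda>w. {v, w}) ` (V - {v})"
    using assms(2) by (auto simp: complete_graph_def card_2_iff)
  moreover have "inj_on (\<lambda>w. {v, w}) (V - {v})"
    by (auto simp: inj_on_def doubleton_eq_iff)
  ultimately show ?thesis
    using assms by (simp add: vertex_degree_def card_image)
qed

text \<open>There are n (n - 1) / 2 edges. For empty \<open>V\<close> the quotient 0 / 0 is 0 by
  convention, while the right-hand side would be -1.\<close>

lemma avg_degree_complete_graph:
  assumes "finite V" "V \<noteq> {}"
  shows "avg_degree (complete_graph V) = real (card V) - 1"
proof -
  have "2 * (card V choose 2) = card V * (card V - 1)"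
    by (cases "card V") (simp_all add: choose_two)
  then have "2 * real (card V choose 2) = real (card V) * (real (card V) - 1)"
    using assms
    by (metis card_gt_0_iff of_nat_mult of_nat_numeral of_nat_1 of_nat_diff Suc_leI One_nat_def)
  then show ?thesis
    using assms by (simp add: avg_degree_def complete_graph_def n_subsets)
qed

text \<open>Here A = J - I and D = (n - 1) I, so D - A = n I - J and D + A = (n - 2) I + J. The
  pairs (a, b) are (-1, 1), (n, -1) and (n - 2, 1), and a + n b gives the remaining
  eigenvalue.\<close>

lemma spectra_complete_graph:
  assumes "finite V" "V \<noteq> {}"
  shows spec_complete_graph:
      "spec (complete_graph V) = replicate_mset (card V - 1) (- 1) + {# real (card V) - 1 #}"
    and L_spec_complete_graph:
      "L_spec (complete_graph V) = {# 0 #} + replicate_mset (card V - 1) (real (card V))"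
    and Q_spec_complete_graph:
      "Q_spec (complete_graph V) =
       replicate_mset (card V - 1) (real (card V) - 2) + {# 2 * (real (card V) - 1) #}"
proof -
  let ?n = "card V"
  have n: "?n > 0" using assms by (simp add: card_gt_0_iff)
  obtain vs where vs: "distinct vs" "set vs = V"
    using finite_distinct_list[OF assms(1)] by blast
  have len: "length vs = ?n" using distinct_card vs by fastforce
  have vs': "set vs = verts (complete_graph V)"
    using vs by (simp add: complete_graph_def)
  have mem: "vs ! i \<in> V" if "i < ?n" for i
    using that vs len nth_mem by fastforce
  have A: "adjacency_matrix (complete_graph V) vs =
           mat ?n ?n (\<lambda>(i, j). if i = j then 0 else 1)"
    using vs len mem
    by (auto simp: adjacency_matrix_def edges_complete_graph_iff nth_eq_iff_index_eq intro!: eq_matI)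
  have D: "degree_matrix (complete_graph V) vs =
           mat ?n ?n (\<lambda>(i, j). if i = j then real ?n - 1 else 0)"
    using vs len mem n assms
    by (auto simp: degree_matrix_def vertex_degree_complete_graph intro!: eq_matI)
  note scalar = eigenvalue_mset_scalar_plus_ones[OF n]
  show "spec (complete_graph V) = replicate_mset (?n - 1) (- 1) + {# real ?n - 1 #}"
    unfolding spec_eq[OF vs(1) vs'] A using scalar[of "- 1" 1] by (simp cong: if_cong)
  have "degree_matrix (complete_graph V) vs - adjacency_matrix (complete_graph V) vs =
        mat ?n ?n (\<lambda>(i, j). if i = j then real ?n + - 1 else - 1)"
    unfolding A D by (intro eq_matI) auto
  then show "L_spec (complete_graph V) = {# 0 #} + replicate_mset (?n - 1) (real ?n)"
    unfolding L_spec_eq[OF vs(1) vs'] using scalar[of "real ?n" "- 1"] by simp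
  have "degree_matrix (complete_graph V) vs + adjacency_matrix (complete_graph V) vs =
        mat ?n ?n (\<lambda>(i, j). if i = j then (real ?n - 2) + 1 else 1)"
    unfolding A D by (intro eq_matI) auto
  then show "Q_spec (complete_graph V) =
        replicate_mset (?n - 1) (real ?n - 2) + {# 2 * (real ?n - 1) #}"
    unfolding Q_spec_eq[OF vs(1) vs'] using scalar[of "real ?n - 2" 1] by (simp add: algebra_simps)
qed

text \<open>In all three cases n - 1 eigenvalues lie at distance 1 from the centre and the remaining
  one at distance n - 1. The centre is 0 for \<open>energy\<close> and the average degree n - 1 for
  the other two.\<close>

lemma energies_complete_graph:
  assumes "finite V" "V \<noteq> {}"
  shows energy_complete_graph: "energy (complete_graph V) = 2 * (real (card V) - 1)"
    and L_energy_complete_graph: "L_energy (complete_graph V) = 2 * (real (card V) - 1)"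
    and Q_energy_complete_graph: "Q_energy (complete_graph V) = 2 * (real (card V) - 1)"
proof -
  have "real (card V) \<ge> 1" using assms by (simp add: Suc_leI card_gt_0_iff)
  then show "energy (complete_graph V) = 2 * (real (card V) - 1)"
    "L_energy (complete_graph V) = 2 * (real (card V) - 1)"
    "Q_energy (complete_graph V) = 2 * (real (card V) - 1)"
    using assms
    by (simp_all add: energy_def L_energy_def Q_energy_def spectra_complete_graph
        avg_degree_complete_graph of_nat_diff)
qed

section \<open>Engel commutators, nilpotent subgroups and the Fitting subgroup\<close>

lemma (in group) commutator_closed:
  "x \<in> carrier G \<Longrightarrow> y \<in> carrier G \<Longrightarrow> commutator G x y \<in> carrier G"
  by (simp add: commutator_def)

lemma (in group) engel_closed:
  "x \<in> carrier G \<Longrightarrow> y \<in> carrier G \<Longrightarrow> engel G x y k \<in> carrier G"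
  by (induction k) (simp_all add: commutator_closed)

lemma (in group) engel_in_lower_central_series:
  "x \<in> carrier G \<Longrightarrow> y \<in> carrier G \<Longrightarrow> engel G x y n \<in> lower_central_series G n"
  by (induction n) (auto intro!: generate.incl)

lemma (in group) commutator_subgroup:
  assumes "subgroup H G" "x \<in> H" "y \<in> H"
  shows "commutator (G\<lparr>carrier := H\<rparr>) x y = commutator G x y"
  using assms by (simp add: commutator_def m_inv_consistent)

text \<open>Lets the lower central series of \<open>H\<close>, which is formed inside
  \<open>H\<close>, yield statements about commutators in \<open>G\<close>.\<close>

lemma (in group) engel_subgroup:
  assumes H: "subgroup H G" and "x \<in> H" "y \<in> H"
  shows "engel (G\<lparr>carrier := H\<rparr>) x y k = engel G x y k"
proof (induction k)
  case (Suc k)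
  interpret H: group "G\<lparr>carrier := H\<rparr>" by (rule subgroup_imp_group[OF H])
  have "engel G x y k \<in> H"
    using H.engel_closed[of x y k] Suc assms by simp
  then show ?case using Suc assms by (simp add: commutator_subgroup)
qed simp

text \<open>Iterated commutators descend along the lower central series, so the stage at which it
  becomes trivial serves all x and y at once.\<close>

lemma (in group) nilpotent_subgroup_engel:
  assumes H: "subgroup H G" and nil: "nilpotent_group (G\<lparr>carrier := H\<rparr>)"
  obtains n where "\<And>x y. x \<in> H \<Longrightarrow> y \<in> H \<Longrightarrow> engel G x y n = \<one>"
proof -
  interpret H: group "G\<lparr>carrier := H\<rparr>" by (rule subgroup_imp_group[OF H])
  obtain n where "lower_central_series (G\<lparr>carrier := H\<rparr>) n = {\<one>}"
    using nil by (auto simp: nilpotent_group_def)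
  then have "engel G x y n = \<one>" if "x \<in> H" "y \<in> H" for x y
    using H.engel_in_lower_central_series[of x y n] engel_subgroup[OF H that] that by simp
  then show thesis by (rule that)
qed

text \<open>The recursion adds commutators on the outside; peeling off the innermost one allows a
  start from [x, y], which may lie in a normal subgroup when x does not.\<close>

lemma engel_Suc_left: "engel G x y (Suc k) = engel G (commutator G x y) y k"
  by (induction k) simp_all

text \<open>Since [x, y] = (y x)^-1 (x y), the lower central series is trivial after one
  step.\<close>

lemma (in group) abelian_subgroup_nilpotent:
  assumes H: "subgroup H G" and comm: "\<And>x y. x \<in> H \<Longrightarrow> y \<in> H \<Longrightarrow> x \<otimes> y = y \<otimes> x"
  shows "nilpotent_group (G\<lparr>carrier := H\<rparr>)"
proof -
  interpret H: group "G\<lparr>carrier := H\<rparr>" by (rule subgroup_imp_group[OF H])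
  have 1: "commutator G x y = \<one>" if "x \<in> H" "y \<in> H" for x y
  proof -
    have c: "x \<in> carrier G" "y \<in> carrier G" using that H subgroup.subset by blast+
    have "inv x \<otimes> inv y \<otimes> x \<otimes> y = inv (y \<otimes> x) \<otimes> (x \<otimes> y)"
      using c by (simp add: inv_mult_group m_assoc)
    then show ?thesis using c comm[OF that] by (simp add: commutator_def)
  qed
  have "{commutator (G\<lparr>carrier := H\<rparr>) x y | x y. x \<in> H \<and> y \<in> H} = {\<one>}"
  proof (intro equalityI subsetI)
    fix z assume "z \<in> {\<one>}"
    then have "z = commutator (G\<lparr>carrier := H\<rparr>) \<one> \<one>"
      using 1 subgroup.one_closed[OF H] by (simp add: commutator_subgroup[OF H])
    then show "z \<in> {commutator (G\<lparr>carrier := H\<rparr>) x y | x y. x \<in> H \<and> y \<in> H}"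
      using subgroup.one_closed[OF H] by blast
  qed (auto simp: commutator_subgroup[OF H] 1)
  then have "lower_central_series (G\<lparr>carrier := H\<rparr>) (Suc 0) = {\<one>}"
    using H.generate_one by simp
  then show ?thesis
    unfolding nilpotent_group_def using H.is_group by (intro conjI exI[of _ "Suc 0"]) simp_all
qed

text \<open>
  If \<open>t\<close> lies in a nilpotent normal subgroup \<open>N\<close> and \<open>s\<close> is arbitrary, then \<open>[s, t] \<in> N\<close>, so
  \<open>[s, \<^sub>k t] = 1\<close> for some \<open>k \<ge> 1\<close>.
\<close>

lemma (in group) fitting_subgroup_eqI:
  assumes A: "A \<lhd> G" and comm: "\<And>x y. x \<in> A \<Longrightarrow> y \<in> A \<Longrightarrow> x \<otimes> y = y \<otimes> x"
    and engel: "\<And>t. t \<in> carrier G - A \<Longrightarrow> \<exists>s\<in>carrier G. \<forall>k\<ge>1. engel G s t k \<noteq> \<one>"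
  shows "fitting_subgroup G = A"
proof -
  have subA: "subgroup A G" using A by (rule normal_imp_subgroup)
  have "N \<subseteq> A" if N: "N \<lhd> G" and nil: "nilpotent_group (G\<lparr>carrier := N\<rparr>)" for N
  proof (rule ccontr)
    assume "\<not> N \<subseteq> A"
    then obtain t where t: "t \<in> N" "t \<notin> A" by blast
    have subN: "subgroup N G" using N by (rule normal_imp_subgroup)
    then have tc: "t \<in> carrier G" using t subgroup.subset by blast
    then obtain s where s: "s \<in> carrier G" and ne: "\<forall>k\<ge>1. engel G s t k \<noteq> \<one>"
      using engel t by blast
    have "inv s \<otimes> inv t \<otimes> s \<in> N"
      using normal.inv_op_closed1[OF N s] subgroup.m_inv_closed[OF subN t(1)] by blast
    then have "commutator G s t \<in> N"
      unfolding commutator_def using t(1) subgroup.m_closed[OF subN] by blast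
    moreover obtain n where "\<And>x y. x \<in> N \<Longrightarrow> y \<in> N \<Longrightarrow> engel G x y n = \<one>"
      using nilpotent_subgroup_engel[OF subN nil] by blast
    \<comment> \<open>The first commutator, which enters \<open>N\<close>, accounts for the extra
      step; the index is thus positive even if n = 0.\<close>
    ultimately have "engel G s t (Suc n) = \<one>"
      using t(1) by (metis engel_Suc_left)
    then show False using ne by (metis le_add1 plus_1_eq_Suc)
  qed
  moreover have "nilpotent_group (G\<lparr>carrier := A\<rparr>)"
    using subA comm by (rule abelian_subgroup_nilpotent)
  ultimately have "\<Union>{N. N \<lhd> G \<and> nilpotent_group (G\<lparr>carrier := N\<rparr>)} = A"
    using A by blast
  moreover have "generate G A = A"
    using generate_subgroup_incl[OF subset_refl subA] by (auto intro: generate.incl)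
  ultimately show ?thesis by (simp add: fitting_subgroup_def)
qed

text \<open>The Engel hypothesis serves twice: it keeps each element outside \<open>A\<close> out of
  the Fitting subgroup, and it makes any two such elements adjacent. The cardinality bound supplies
  a second element s as the witness against t.\<close>

lemma (in group) engel_graph_eq_complete_graph:
  assumes A: "A \<lhd> G" and comm: "\<And>x y. x \<in> A \<Longrightarrow> y \<in> A \<Longrightarrow> x \<otimes> y = y \<otimes> x"
    and engel: "\<And>x y k. x \<in> carrier G - A \<Longrightarrow> y \<in> carrier G - A \<Longrightarrow> x \<noteq> y \<Longrightarrow> k \<ge> 1 \<Longrightarrow>
                  engel G x y k \<noteq> \<one>"
    and card: "card (carrier G - A) \<ge> 2"
  shows "engel_graph G = complete_graph (carrier G - A)"
proof -
  have "\<exists>s\<in>carrier G. \<forall>k\<ge>1. engel G s t k \<noteq> \<one>" if t: "t \<in> carrier G - A" for t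
  proof -
    have "\<not> carrier G - A \<subseteq> {t}"
      using card card_mono[of "{t}" "carrier G - A"] by auto
    then show ?thesis using engel t by blast
  qed
  then have "fitting_subgroup G = A"
    using A comm by (intro fitting_subgroup_eqI) auto
  then have V: "carrier G - fitting_subgroup G = carrier G - A" by simp
  have "{{x, y} | x y. x \<in> carrier G - A \<and> y \<in> carrier G - A \<and> x \<noteq> y \<and>
                       (\<forall>k\<ge>1. engel G x y k \<noteq> \<one> \<and> engel G y x k \<noteq> \<one>)} =
        {{x, y} | x y. x \<in> carrier G - A \<and> y \<in> carrier G - A \<and> x \<noteq> y}"
    using engel by (intro Collect_cong ex_cong1) blast
  also have "\<dots> = {e. e \<subseteq> carrier G - A \<and> card e = 2}"
    unfolding card_2_iff by blast
  finally show ?thesis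
    unfolding engel_graph_def complete_graph_def V by simp
qed

section \<open>Transport along homomorphisms, and commutators in the dihedral group\<close>

lemma (in group_hom) hom_commutator:
  "x \<in> carrier G \<Longrightarrow> y \<in> carrier G \<Longrightarrow> h (commutator G x y) = commutator H (h x) (h y)"
  by (simp add: commutator_def)

lemma (in group_hom) hom_engel:
  "x \<in> carrier G \<Longrightarrow> y \<in> carrier G \<Longrightarrow> h (engel G x y k) = engel H (h x) (h y) k"
  by (induction k) (simp_all add: hom_commutator G.engel_closed)

lemma inv_dihedral_group:
  assumes "m > 0" "i \<in> {0..<int m}"
  shows "inv\<^bsub>dihedral_group m\<^esub> (i, s) = (if s then i else (- i) mod int m, s)"
  by (rule group.inv_equality[OF group_dihedral_group])
    (use assms in \<open>auto simp: dihedral_group_def mod_simps\<close>)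

text \<open>Reflections are involutions, so two of them satisfy [x, y] = (x y)^2. Conjugation by a
  reflection inverts a rotation r, so the commutator of r with it is r^-2, whatever j is.\<close>

lemma commutator_dihedral_group:
  assumes "m > 0" "i \<in> {0..<int m}" "j \<in> {0..<int m}"
  shows "commutator (dihedral_group m) (i, s) (j, True) =
         ((if s then 2 * (i - j) else - 2 * i) mod int m, False)"
  using assms unfolding commutator_def
  by (auto simp: inv_dihedral_group) (auto simp: dihedral_group_def mod_simps algebra_simps)

text \<open>The first commutator is already a rotation, and each further one multiplies its exponent
  by -2.\<close>

lemma engel_dihedral_group:
  assumes "m > 0" "i \<in> {0..<int m}" "j \<in> {0..<int m}"
  shows "engel (dihedral_group m) (i, True) (j, True) (Suc k) =
         (((- 2) ^ k * 2 * (i - j)) mod int m, False)"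
proof (induction k)
  case 0
  then show ?case using assms by (simp add: commutator_dihedral_group)
next
  case (Suc k)
  let ?c = "(- 2) ^ k * 2 * (i - j)"
  have "engel (dihedral_group m) (i, True) (j, True) (Suc (Suc k)) =
        commutator (dihedral_group m) (?c mod int m, False) (j, True)"
    using Suc by (subst engel.simps) (simp only:)
  also have "\<dots> = ((- 2 * (?c mod int m)) mod int m, False)"
    using assms by (subst commutator_dihedral_group) auto
  also have "\<dots> = ((- 2 * ?c) mod int m, False)"
    by (simp only: mod_mult_right_eq)
  also have "\<dots> = (((- 2) ^ Suc k * 2 * (i - j)) mod int m, False)"
    by (simp only: power_Suc mult.assoc)
  finally show ?case .
qed

text \<open>Up to sign the factor in front of i - j is a power of 2, hence a unit modulo odd
  \<open>m\<close>. A trivial commutator would force i and j to be congruent modulo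
  \<open>m\<close>, hence equal in the range of representatives.\<close>

lemma engel_dihedral_group_neq_one:
  assumes "odd m" and ij: "i \<in> {0..<int m}" "j \<in> {0..<int m}" "i \<noteq> j" and "k \<ge> 1"
  shows "engel (dihedral_group m) (i, True) (j, True) k \<noteq> \<one>\<^bsub>dihedral_group m\<^esub>"
proof
  assume *: "engel (dihedral_group m) (i, True) (j, True) k = \<one>\<^bsub>dihedral_group m\<^esub>"
  obtain l where l: "k = Suc l" using \<open>k \<ge> 1\<close> by (cases k) auto
  have "m > 0" using \<open>odd m\<close> by (cases m) auto
  then have "int m dvd (- 2) ^ l * 2 * (i - j)"
    using * unfolding l engel_dihedral_group[OF \<open>m > 0\<close> ij(1,2)]
    by (simp add: dihedral_group_def mod_eq_0_iff_dvd)
  moreover have "coprime (int m) ((- 2) ^ l * 2)"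
    using \<open>odd m\<close> by simp
  ultimately have "int m dvd i - j"
    by (metis coprime_dvd_mult_right_iff)
  then have "i mod int m = j mod int m"
    by (simp add: mod_eq_dvd_iff)
  then show False using ij by simp
qed

section \<open>The graph of a group isomorphic to a dihedral group\<close>

lemma engel_graph_dihedral:
  assumes "m \<ge> 3" "odd m" "group G" "G \<cong> dihedral_group m"
  obtains V where "finite V" "card V = m" "engel_graph G = complete_graph V"
proof -
  obtain h where h: "h \<in> iso G (dihedral_group m)"
    using assms(4) by (auto simp: is_iso_def)
  interpret group G by fact
  interpret h: group_hom G "dihedral_group m" h
    using h assms by (auto simp: group_hom_def group_hom_axioms_def iso_def intro: group_dihedral_group)
  have bij: "bij_betw h (carrier G) ({0..<int m} \<times> UNIV)"
    using h by (simp add: iso_def dihedral_group_def)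
  then have inj: "inj_on h (carrier G)" by (simp add: bij_betw_def)
  define A where "A = {x \<in> carrier G. \<not> snd (h x)}"
  \<comment> \<open>The map \<open>snd\<close> after \<open>h\<close> is a homomorphism to the group
    of order 2, with exclusive or as product; \<open>A\<close>, the preimage of the rotations, is
    its kernel.\<close>
  have snd_mult: "snd (h (x \<otimes>\<^bsub>G\<^esub> y)) \<longleftrightarrow> snd (h x) \<noteq> snd (h y)"
    if "x \<in> carrier G" "y \<in> carrier G" for x y
    using that by (simp add: dihedral_group_def split_beta)
  have snd_one: "\<not> snd (h \<one>\<^bsub>G\<^esub>)" by (simp add: dihedral_group_def)
  have snd_inv: "snd (h (inv\<^bsub>G\<^esub> x)) \<longleftrightarrow> snd (h x)" if "x \<in> carrier G" for x
    using snd_mult[of x "inv\<^bsub>G\<^esub> x"] snd_one that by auto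
  have subA: "subgroup A G"
    by (rule subgroupI) (use snd_one in \<open>auto simp: A_def snd_mult snd_inv simp del: h.hom_mult h.hom_inv\<close>)
  have normA: "A \<lhd> G"
    by (rule normal_invI[OF subA])
      (auto simp: A_def snd_mult snd_inv simp del: h.hom_mult h.hom_inv)
  have comm: "x \<otimes>\<^bsub>G\<^esub> y = y \<otimes>\<^bsub>G\<^esub> x" if "x \<in> A" "y \<in> A" for x y
    using that
    by (intro inj_onD[OF inj]) (auto simp: A_def dihedral_group_def split_beta add.commute)
  have refl: "\<exists>i\<in>{0..<int m}. h x = (i, True)" if "x \<in> carrier G - A" for x
    using that bij_betwE[OF bij] by (force simp: A_def)
  have engel: "engel G x y k \<noteq> \<one>\<^bsub>G\<^esub>"
    if xy: "x \<in> carrier G - A" "y \<in> carrier G - A" "x \<noteq> y" and "k \<ge> 1" for x y k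
  proof
    assume "engel G x y k = \<one>\<^bsub>G\<^esub>"
    then have "engel (dihedral_group m) (h x) (h y) k = \<one>\<^bsub>dihedral_group m\<^esub>"
      using xy h.hom_engel[of x y k] by simp
    moreover have "h x \<noteq> h y" using xy inj by (auto dest: inj_onD)
    ultimately show False
      using refl[OF xy(1)] refl[OF xy(2)] engel_dihedral_group_neq_one[OF \<open>odd m\<close>] \<open>k \<ge> 1\<close> by metis
  qed
  \<comment> \<open>The vertices correspond to the \<open>m\<close> reflections, which gives their
    number.\<close>
  have "h ` (carrier G - A) = {0..<int m} \<times> {True}"
  proof -
    have "h ` (carrier G - A) = {p \<in> h ` carrier G. snd p}" by (auto simp: A_def)
    then show ?thesis using bij by (auto simp: bij_betw_def)
  qed
  then have bij': "bij_betw h (carrier G - A) ({0..<int m} \<times> {True})"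
    using inj by (auto simp: bij_betw_def intro: inj_on_subset)
  have V: "finite (carrier G - A)" "card (carrier G - A) = m"
    using bij_betw_finite[OF bij'] bij_betw_same_card[OF bij'] by (auto simp: card_cartesian_product)
  moreover have "engel_graph G = complete_graph (carrier G - A)"
    using normA comm engel V \<open>m \<ge> 3\<close> by (intro engel_graph_eq_complete_graph) auto
  ultimately show thesis by (rule that)
qed

theorem theorem8p3:
  fixes G :: "('a, 'b) monoid_scheme" and m :: nat
  assumes "m \<ge> 3" and "odd m"
    and "group G" and "G \<cong> dihedral_group m"
  defines "\<Gamma> \<equiv> engel_graph G"
  shows "spec \<Gamma> = replicate_mset (m - 1) (- 1) + {# real m - 1 #} \<and>
         L_spec \<Gamma> = {# 0 #} + replicate_mset (m - 1) (real m) \<and>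
         Q_spec \<Gamma> = replicate_mset (m - 1) (real m - 2) + {# 2 * (real m - 1) #} \<and>
         energy \<Gamma> = 2 * (real m - 1) \<and>
         L_energy \<Gamma> = 2 * (real m - 1) \<and>
         Q_energy \<Gamma> = 2 * (real m - 1)"
proof -
  obtain V where V: "finite V" "card V = m" "\<Gamma> = complete_graph V"
    using engel_graph_dihedral[OF assms(1-4)] unfolding \<Gamma>_def .
  have "V \<noteq> {}" using V \<open>m \<ge> 3\<close> by auto
  then show ?thesis
    using spectra_complete_graph[of V] energies_complete_graph[of V] V by simp
qed

end
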